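(* Let $n\ge2$ and let $\mathbf p=(p_1,\dots,p_n)$ with $p_i>0$, $\sum_i p_i=1$, be generic. Then for every integer $j$ with $0\le j\le n-1$, $$\mathbb E_{\mu_H}\bigl[Q_j(\theta)\bigr]=\mathbb E_{\mathrm{unif}^{\otimes n}}\bigl[Q_j(\theta)\bigr],$$ where $\mathrm{unif}^{\otimes n}$ is the law of $n$ independent uniform random variables on $[0,1)$ and $\mu_H$ is the Haar probability measure on the sub-torus $H$.
   Context: $\mathbf p$ is called generic if $\{v\in\mathbb Z^n: v\cdot\mathbf p\in\mathbb Z\}=\mathbb Z\cdot(1,\dots,1)$. With $\mathbb T=\mathbb R/\mathbb Z$ (represented by $[0,1)$), $H=\{\theta\in\mathbb T^n:\sum_i\theta_i\equiv0\ (\mathrm{mod}\ 1)\}$. For $\theta\in[0,1)^n$ define $$c_k(\theta)=\frac{(-1)^{k+1}}{k(k+1)}\Bigl[B_{k+1}-\sum_{i=1}^n p_i^{-k}B_{k+1}(1-\theta_i)\Bigr]\quad(k\ge1),$$ where $B_k(x)$ are Bernoulli polynomials and $B_k=B_k(0)$, and define $Q_j(\theta)$ by the formal identity $\exp\bigl(\sum_{k\ge1}c_k(\theta)x^k\bigr)=\sum_{j\ge0}Q_j(\theta)x^j$. (For generic $\mathbf p$ the sequence $\theta(N)=(\{Np_1\},\dots,\{Np_n\})$, $N=1,2,\dots$, is equidistributed on $H$ with respect to $\mu_H$ by Weyl's theorem, so $\mathbb E_{\mu_H}[Q_j(\theta)]$ is the Cesàro mean of $Q_j(\theta(N))$.)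 *)

theory Defs
  imports "HOL-Probability.Probability" "HOL-Computational_Algebra.Computational_Algebra"
begin

section \<open>Genericity\<close>

text \<open>Integer vectors are indexed by \<^term>\<open>{1..n}\<close> and represented by extensional functions.\<close>

definition generic :: "nat \<Rightarrow> (nat \<Rightarrow> real) \<Rightarrow> bool" where
  "generic n p \<longleftrightarrow>
     {v \<in> {1..n} \<rightarrow>\<^sub>E (UNIV :: int set). (\<Sum>i=1..n. of_int (v i) * p i) \<in> \<int>}
       = range (\<lambda>c :: int. \<lambda>i\<in>{1..n}. c)"


section \<open>Bernoulli polynomials and the functions \<open>Q\<close>\<close>

text \<open>The generating function is \<open>t e\<^sup>x\<^sup>t / (e\<^sup>t - 1) = (\<Sum>k. B\<^sub>k(x) t\<^sup>k / k!)\<close>.  The denominator has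
  subdegree 1, so the quotient is the one in the ring of power series (see \<open>bernoulli_gf\<close>).\<close>

definition bernoulli_poly :: "nat \<Rightarrow> real \<Rightarrow> real" where
  "bernoulli_poly k x = fact k * fps_nth (fps_X * fps_exp x / (fps_exp 1 - 1)) k"

definition cfun :: "nat \<Rightarrow> (nat \<Rightarrow> real) \<Rightarrow> nat \<Rightarrow> (nat \<Rightarrow> real) \<Rightarrow> real" where
  "cfun n p k \<theta> = (-1) ^ (k + 1) / (real k * (real k + 1)) *
     (bernoulli_poly (k + 1) 0
       - (\<Sum>i=1..n. p i powi (- int k) * bernoulli_poly (k + 1) (1 - \<theta> i)))"

definition Qfun :: "nat \<Rightarrow> (nat \<Rightarrow> real) \<Rightarrow> nat \<Rightarrow> (nat \<Rightarrow> real) \<Rightarrow> real" where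
  "Qfun n p j \<theta> =
     fps_nth (fps_compose (fps_exp 1) (Abs_fps (\<lambda>k. if k = 0 then 0 else cfun n p k \<theta>))) j"


section \<open>The torus and its subgroup \<open>H\<close>\<close>

text \<open>Under the identification of \<open>\<real>/\<int>\<close> with \<^term>\<open>{0..<1::real}\<close> the Borel sets of the quotient
  topology are the Borel subsets of \<^term>\<open>{0..<1::real}\<close> (the two topologies differ, the
  sigma-algebras do not), and the Borel sets of the \<open>n\<close>-torus form the product sigma-algebra.\<close>

definition torus_borel :: "nat \<Rightarrow> (nat \<Rightarrow> real) measure" where
  "torus_borel n = (\<Pi>\<^sub>M i\<in>{1..n}. restrict_space borel {0..<1})"

definition torus_add :: "nat \<Rightarrow> (nat \<Rightarrow> real) \<Rightarrow> (nat \<Rightarrow> real) \<Rightarrow> (nat \<Rightarrow> real)" where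
  "torus_add n \<phi> \<theta> = (\<lambda>i\<in>{1..n}. frac (\<phi> i + \<theta> i))"

definition torus_H :: "nat \<Rightarrow> (nat \<Rightarrow> real) set" where
  "torus_H n = {\<theta> \<in> {1..n} \<rightarrow>\<^sub>E {0..<1}. (\<Sum>i=1..n. \<theta> i) \<in> \<int>}"

definition H_borel :: "nat \<Rightarrow> (nat \<Rightarrow> real) measure" where
  "H_borel n = restrict_space (torus_borel n) (torus_H n)"

text \<open>The Haar probability measure of the compact group \<open>H\<close>: a translation-invariant Borel
  probability measure.  Existence is \<open>haar_prob_H_exists\<close> below.\<close>

definition haar_prob_H :: "nat \<Rightarrow> (nat \<Rightarrow> real) measure \<Rightarrow> bool" where
  "haar_prob_H n \<mu> \<longleftrightarrow>
     prob_space \<mu> \<and> sets \<mu> = sets (H_borel n) \<and>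
     (\<forall>\<phi>\<in>torus_H n. distr \<mu> \<mu> (torus_add n \<phi>) = \<mu>)"

definition unif_product :: "nat \<Rightarrow> (nat \<Rightarrow> real) measure" where
  "unif_product n = (\<Pi>\<^sub>M i\<in>{1..n}. uniform_measure lborel {0..<1})"


section \<open>The definitions are the intended ones\<close>

lemma bernoulli_gf:
  "Abs_fps (\<lambda>k. bernoulli_poly k x / fact k) * (fps_exp 1 - 1) = fps_X * fps_exp x"
proof -
  let ?g = "fps_exp (1::real) - 1"
  have nz: "?g \<noteq> 0" and sd: "subdegree ?g = 1"
  proof -
    have "?g $ 1 \<noteq> 0" by simp
    then show "?g \<noteq> 0" by force
    show "subdegree ?g = 1" by (rule subdegreeI) auto
  qed
  have "?g dvd fps_X * fps_exp x"
    using nz sd by (simp add: fps_dvd_iff)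
  moreover have "Abs_fps (\<lambda>k. bernoulli_poly k x / fact k) = fps_X * fps_exp x / ?g"
    by (rule fps_ext) (simp add: bernoulli_poly_def)
  ultimately show ?thesis by (metis dvd_div_mult_self)
qed

definition unit_measure :: "real measure" where
  "unit_measure = restrict_space lborel {0..<1}"

lemma space_unit_measure [simp]: "space unit_measure = {0..<1}"
  by (simp add: unit_measure_def space_restrict_space)

lemma sets_unit_measure [measurable_cong]:
  "sets unit_measure = sets (restrict_space borel {0..<1})"
  by (simp add: unit_measure_def sets_restrict_space)

lemma emeasure_unit_measure:
  "A \<in> sets unit_measure \<Longrightarrow> emeasure unit_measure A = emeasure lborel A"
  unfolding unit_measure_def
  by (rule emeasure_restrict_space) (auto simp: sets_restrict_space)

lemma prob_space_unit_measure: "prob_space unit_measure"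
proof (rule prob_spaceI)
  show "emeasure unit_measure (space unit_measure) = 1"
    by (subst emeasure_unit_measure) (rule sets.top, simp)
qed

lemma frac_measurable_unit:
  "f \<in> borel_measurable M \<Longrightarrow>
    (\<lambda>x. frac (f x :: real)) \<in> measurable M (restrict_space borel {0..<1})"
  by (rule measurable_restrict_space2) (auto simp: frac_lt_1, simp add: frac_def)

lemma id_unit_borel: "(\<lambda>x. x) \<in> measurable (restrict_space borel {0..<1::real}) borel"
  by (rule measurable_restrict_space1) simp

lemma unit_measure_translate:
  "distr unit_measure unit_measure (\<lambda>x. frac (t + x)) = unit_measure"
proof (rule measure_eqI)
  fix A assume "A \<in> sets (distr unit_measure unit_measure (\<lambda>x. frac (t + x)))"
  then have A: "A \<in> sets unit_measure" by simp
  then have Ab: "A \<in> sets borel" and A1: "A \<subseteq> {0..<1}"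
    by (auto simp: sets_unit_measure sets_restrict_space)
  define s where "s = frac t"
  have s: "0 \<le> s" "s < 1" by (auto simp: s_def frac_lt_1)
  have tr: "emeasure lborel ((\<lambda>x. c + x) -` B) = emeasure lborel B" if "B \<in> sets borel" for B and c :: real
  proof -
    have "emeasure lborel B = emeasure (distr lborel borel ((+) c)) B"
      by (simp add: lborel_distr_plus)
    also have "\<dots> = emeasure lborel ((\<lambda>x. c + x) -` B)"
      using that by (subst emeasure_distr) auto
    finally show ?thesis by simp
  qed
  have meas: "(\<lambda>x. frac (t + x)) \<in> measurable unit_measure unit_measure"
    unfolding measurable_cong_sets[OF refl sets_unit_measure] measurable_cong_sets[OF sets_unit_measure refl]
    by (intro frac_measurable_unit borel_measurable_add id_unit_borel) simp
  have fr: "frac (t + x) = (if x < 1 - s then s + x else (s - 1) + x)" if "x \<in> {0..<1}" for x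
  proof -
    have "frac x = x" using that by simp
    then show ?thesis unfolding frac_add s_def by auto
  qed
  let ?B1 = "(\<lambda>x. s + x) -` (A \<inter> {s..<1})" and ?B2 = "(\<lambda>x. (s - 1) + x) -` (A \<inter> {0..<s})"
  have pre: "(\<lambda>x. frac (t + x)) -` A \<inter> space unit_measure = ?B1 \<union> ?B2"
    using A1 s fr by (force split: if_splits)
  have mb: "?B1 \<in> sets borel" "?B2 \<in> sets borel"
    using Ab by (auto intro!: measurable_sets_borel[where M=borel])
  have "emeasure (distr unit_measure unit_measure (\<lambda>x. frac (t + x))) A
      = emeasure lborel (?B1 \<union> ?B2)"
    using A meas measurable_sets[OF meas A] pre by (simp add: emeasure_distr emeasure_unit_measure)
  also have "\<dots> = emeasure lborel ?B1 + emeasure lborel ?B2"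
    using mb by (intro plus_emeasure[symmetric]) auto
  also have "\<dots> = emeasure lborel (A \<inter> {s..<1}) + emeasure lborel (A \<inter> {0..<s})"
    using Ab by (simp only: tr sets.Int atLeastLessThan_borel)
  also have "\<dots> = emeasure lborel ((A \<inter> {s..<1}) \<union> (A \<inter> {0..<s}))"
    using Ab by (intro plus_emeasure) auto
  also have "(A \<inter> {s..<1}) \<union> (A \<inter> {0..<s}) = A" using A1 s by auto
  finally show "emeasure (distr unit_measure unit_measure (\<lambda>x. frac (t + x))) A = emeasure unit_measure A"
    using A by (simp add: emeasure_unit_measure)
qed simp

lemma PiM_unit_translate:
  fixes \<phi> :: "nat \<Rightarrow> real" and I :: "nat set"
  assumes "finite I"
  defines "P \<equiv> PiM I (\<lambda>_. unit_measure)"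
  defines "T \<equiv> (\<lambda>x. \<lambda>i\<in>I. frac (\<phi> i + x i))"
  shows "T \<in> measurable P P" and "distr P P T = P"
proof -
  have m1: "(\<lambda>x. frac (\<phi> i + x)) \<in> measurable unit_measure unit_measure" for i
    unfolding measurable_cong_sets[OF refl sets_unit_measure] measurable_cong_sets[OF sets_unit_measure refl]
    by (intro frac_measurable_unit borel_measurable_add id_unit_borel) simp
  show T: "T \<in> measurable P P"
    unfolding T_def P_def
  proof (rule measurable_restrict)
    fix i assume "i \<in> I"
    then have "(\<lambda>x. x i) \<in> measurable (PiM I (\<lambda>_. unit_measure)) unit_measure"
      by (rule measurable_component_singleton)
    then show "(\<lambda>x. frac (\<phi> i + x i)) \<in> measurable (PiM I (\<lambda>_. unit_measure)) unit_measure"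
      by (rule measurable_compose[OF _ m1])
  qed
  interpret product_sigma_finite "\<lambda>_. unit_measure"
    using prob_space_unit_measure
    by (simp add: product_sigma_finite_def prob_space_imp_sigma_finite)
  show "distr P P T = P"
    unfolding P_def
  proof (rule PiM_eqI[OF \<open>finite I\<close>])
    show "sets (distr (PiM I (\<lambda>_. unit_measure)) (PiM I (\<lambda>_. unit_measure)) T)
      = sets (PiM I (\<lambda>_. unit_measure))" by simp
    fix A assume A: "\<And>i. i \<in> I \<Longrightarrow> A i \<in> sets unit_measure"
    let ?A' = "\<lambda>i. (\<lambda>x. frac (\<phi> i + x)) -` A i \<inter> space unit_measure"
    have A': "?A' i \<in> sets unit_measure" if "i \<in> I" for i
      using m1 A[OF that] by (rule measurable_sets)
    have "T -` (PiE I A) \<inter> space P = PiE I ?A'"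
      by (auto simp: T_def P_def space_PiM PiE_iff)
    then have "emeasure (distr P P T) (PiE I A) = emeasure P (PiE I ?A')"
      using T A by (simp add: emeasure_distr P_def sets_PiM_I_finite \<open>finite I\<close>)
    also have "\<dots> = (\<Prod>i\<in>I. emeasure unit_measure (?A' i))"
      unfolding P_def using A' \<open>finite I\<close> by (intro emeasure_PiM) auto
    also have "\<dots> = (\<Prod>i\<in>I. emeasure unit_measure (A i))"
    proof (rule prod.cong[OF refl])
      fix i assume "i \<in> I"
      then show "emeasure unit_measure (?A' i) = emeasure unit_measure (A i)"
        using emeasure_distr[OF m1 A, of i i] by (simp add: unit_measure_translate)
    qed
    finally show "emeasure (distr (PiM I (\<lambda>_. unit_measure)) (PiM I (\<lambda>_. unit_measure)) T) (PiE I A)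
      = (\<Prod>i\<in>I. emeasure unit_measure (A i))" unfolding P_def .
  qed
qed

lemma space_H_borel: "space (H_borel n) = torus_H n"
  by (auto simp: H_borel_def torus_borel_def torus_H_def space_restrict_space space_PiM)

text \<open>The measure is the image of Lebesgue measure on the first \<open>n - 1\<close> coordinates.\<close>

lemma haar_prob_H_exists:
  assumes "n \<ge> 1"
  shows "\<exists>\<mu>. haar_prob_H n \<mu>"
proof -
  let ?I = "{1..<n}"
  define P where "P = PiM ?I (\<lambda>_. unit_measure)"
  define g :: "(nat \<Rightarrow> real) \<Rightarrow> nat \<Rightarrow> real" where "g = (\<lambda>x. \<lambda>i\<in>{1..n}. if i < n then x i else frac (- (\<Sum>k\<in>?I. x k)))"
  define \<mu> where "\<mu> = distr P (H_borel n) g"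
  have I: "{1..n} = insert n ?I" using assms by auto
  have comp: "(\<lambda>x. x i) \<in> measurable P (restrict_space borel {0..<1})" if "i \<in> ?I" for i
    using measurable_component_singleton[OF that, of "\<lambda>_. unit_measure"]
    unfolding P_def measurable_cong_sets[OF refl sets_unit_measure] .
  have compb: "(\<lambda>x. x i) \<in> borel_measurable P" if "i \<in> ?I" for i
    using measurable_compose[OF comp[OF that] id_unit_borel] .
  have g1: "g \<in> measurable P (torus_borel n)"
    unfolding g_def torus_borel_def
  proof (rule measurable_restrict)
    fix i assume i: "i \<in> {1..n}"
    show "(\<lambda>x. if i < n then x i else frac (- (\<Sum>k\<in>?I. x k)))
        \<in> measurable P (restrict_space borel {0..<1})"
    proof (cases "i < n")
      case True then show ?thesis using i comp by simp
    next
      case False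
      then show ?thesis
        unfolding if_not_P[OF False]
        by (intro frac_measurable_unit borel_measurable_uminus borel_measurable_sum compb)
    qed
  qed
  have gsum: "(\<Sum>i=1..n. g x i) \<in> \<int>" for x
  proof -
    have "(\<Sum>i=1..n. g x i) = frac (- (\<Sum>k\<in>?I. x k)) + (\<Sum>k\<in>?I. x k)"
      unfolding I using assms by (simp add: g_def)
    also have "\<dots> \<in> \<int>" by (simp add: frac_def)
    finally show ?thesis .
  qed
  have g: "g \<in> measurable P (H_borel n)"
    unfolding H_borel_def
  proof (rule measurable_restrict_space2[OF _ g1], rule funcsetI)
    fix x assume "x \<in> space P"
    then have "g x \<in> space (torus_borel n)" using g1 by (rule measurable_space[rotated])
    then show "g x \<in> torus_H n"
      using gsum by (simp add: torus_H_def torus_borel_def space_PiM)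
  qed
  have P: "prob_space P"
    unfolding P_def by (rule prob_space_PiM) (rule prob_space_unit_measure)
  have "distr \<mu> \<mu> (torus_add n \<phi>) = \<mu>" if \<phi>: "\<phi> \<in> torus_H n" for \<phi>
  proof -
    define T where "T = (\<lambda>x. \<lambda>i\<in>?I. frac (\<phi> i + x i))"
    have T: "T \<in> measurable P P" "distr P P T = P"
      using PiM_unit_translate[of ?I \<phi>] by (simp_all add: T_def P_def)
    have add1: "torus_add n \<phi> \<in> measurable (torus_borel n) (torus_borel n)"
      unfolding torus_add_def torus_borel_def
    proof (rule measurable_restrict)
      fix i assume "i \<in> {1..n}"
      then have "(\<lambda>x. x i) \<in> measurable (PiM {1..n} (\<lambda>_. restrict_space borel {0..<1::real}))
          (restrict_space borel {0..<1})"
        by (rule measurable_component_singleton)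
      then have "(\<lambda>x. x i) \<in> borel_measurable (PiM {1..n} (\<lambda>_. restrict_space borel {0..<1::real}))"
        by (rule measurable_compose[OF _ id_unit_borel])
      then show "(\<lambda>x. frac (\<phi> i + x i))
          \<in> measurable (PiM {1..n} (\<lambda>_. restrict_space borel {0..<1})) (restrict_space borel {0..<1})"
        by (intro frac_measurable_unit borel_measurable_add borel_measurable_const)
    qed
    have intsum: "(\<Sum>i\<in>J. frac (f i)) - (\<Sum>i\<in>J. f i) \<in> \<int>" for J :: "nat set" and f :: "nat \<Rightarrow> real"
      unfolding sum_subtractf[symmetric] by (rule Ints_sum) (simp add: frac_def)
    have add: "torus_add n \<phi> \<in> measurable (H_borel n) (H_borel n)"
      unfolding H_borel_def
    proof (rule measurable_restrict_space2[OF _ measurable_restrict_space1[OF add1]], rule funcsetI)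
      fix x assume "x \<in> space (restrict_space (torus_borel n) (torus_H n))"
      then have x: "x \<in> torus_H n" using space_H_borel by (simp add: H_borel_def)
      have "(\<Sum>i=1..n. frac (\<phi> i + x i)) = ((\<Sum>i=1..n. frac (\<phi> i + x i)) - (\<Sum>i=1..n. \<phi> i + x i))
          + ((\<Sum>i=1..n. \<phi> i) + (\<Sum>i=1..n. x i))"
        by (simp add: sum.distrib)
      also have "\<dots> \<in> \<int>"
        using intsum \<phi> x by (intro Ints_add) (auto simp: torus_H_def)
      finally show "torus_add n \<phi> x \<in> torus_H n"
        by (auto simp: torus_H_def torus_add_def frac_lt_1)
    qed
    have comm: "torus_add n \<phi> (g x) = g (T x)" for x
    proof
      fix i
      show "torus_add n \<phi> (g x) i = g (T x) i"
      proof (cases "i = n")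
        case False
        then show ?thesis by (auto simp: torus_add_def g_def T_def)
      next
        case True
        let ?S = "\<Sum>k\<in>?I. x k" and ?F = "\<Sum>k\<in>?I. frac (\<phi> k + x k)"
        have "(\<Sum>k=1..n. \<phi> k) \<in> \<int>" using \<phi> by (simp add: torus_H_def)
        then have s: "\<phi> n + (\<Sum>k\<in>?I. \<phi> k) \<in> \<int>" unfolding I by simp
        have "(\<phi> n - ?S) - (- ?F) = (\<phi> n + (\<Sum>k\<in>?I. \<phi> k)) + (?F - (\<Sum>k\<in>?I. \<phi> k + x k))"
          by (simp add: sum.distrib)
        also have "\<dots> \<in> \<int>" by (rule Ints_add[OF s intsum])
        finally obtain z where "(\<phi> n - ?S) - (- ?F) = of_int z"
          by (rule Ints_cases)
        then have "\<phi> n - ?S = - ?F + of_int z"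
          by linarith
        moreover have "frac (a + of_int z) = frac a" for a :: real
          by (simp add: frac_def)
        ultimately have "frac (\<phi> n - ?S) = frac (- ?F)" by metis
        then show ?thesis using True assms by (simp add: torus_add_def g_def T_def)
      qed
    qed
    have "distr \<mu> \<mu> (torus_add n \<phi>) = distr \<mu> (H_borel n) (torus_add n \<phi>)"
      by (rule distr_cong) (auto simp: \<mu>_def)
    also have "\<dots> = distr P (H_borel n) (torus_add n \<phi> \<circ> g)"
      unfolding \<mu>_def using add g by (rule distr_distr)
    also have "torus_add n \<phi> \<circ> g = g \<circ> T" using comm by auto
    also have "distr P (H_borel n) (g \<circ> T) = distr (distr P P T) (H_borel n) g"
      using g T(1) by (rule distr_distr[symmetric])
    also have "\<dots> = \<mu>" using T(2) by (simp add: \<mu>_def)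
    finally show ?thesis .
  qed
  then have "haar_prob_H n \<mu>"
    unfolding haar_prob_H_def using prob_space.prob_space_distr[OF P g] by (simp add: \<mu>_def)
  then show ?thesis ..
qed

end

theory Submission
  imports Defs
begin

text \<open>Since each \<open>c\<^sub>k\<close> is a sum of a constant and of functions of single coordinates, the
  series \<open>\<Sum>j. Q\<^sub>j x\<^sup>j\<close> is a product of a constant series and of \<open>n\<close> series with constant term 1, the
  \<open>i\<close>-th one depending on \<open>\<theta>\<^sub>i\<close> only.  Hence for \<open>j < n\<close> each monomial in the expansion of \<open>Q\<^sub>j\<close>
  omits at least one coordinate, and any \<open>n - 1\<close> coordinates are independent and uniform under
  the Haar measure of \<open>H\<close>.\<close>

section \<open>Exponentials of formal power series\<close>

text \<open>Comparing coefficients at \<open>l\<close> expresses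
  \<open>(l + 1) * F $ (l + 1)\<close> through \<open>F $ 0, ..., F $ l\<close>. In characteristic 0
  the factor \<open>l + 1\<close> can be cancelled, so zero propagates from the constant
  term.\<close>

lemma fps_linear_ode_unique:
  fixes c F :: "'a :: field_char_0 fps"
  assumes deriv: "fps_deriv F = c * F" and "F $ 0 = 0"
  shows "F = 0"
proof -
  have "F $ k = 0" for k
  proof (induction k rule: less_induct)
    case (less k)
    show ?case
    proof (cases k)
      case 0
      then show ?thesis using assms by simp
    next
      case (Suc l)
      have "of_nat k * F $ k = (c * F) $ l"
        using deriv Suc by (metis fps_deriv_nth Suc_eq_plus1)
      also have "\<dots> = 0"
        unfolding fps_mult_nth using less.IH Suc by (intro sum.neutral) auto
      finally show ?thesis using Suc by (simp del: of_nat_Suc)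
    qed
  qed
  then show ?thesis by (simp add: fps_eq_iff)
qed

text \<open>Both sides have constant term 1 and solve the linear equation F' = (a + b)' F, so
  uniqueness applies to their difference.\<close>

lemma fps_exp_compose_add:
  fixes a b :: "'a :: field_char_0 fps"
  assumes "a $ 0 = 0" "b $ 0 = 0"
  shows "fps_exp 1 oo (a + b) = (fps_exp 1 oo a) * (fps_exp 1 oo b)"
proof -
  let ?E = "\<lambda>c. fps_exp (1 :: 'a) oo c"
  have d: "fps_deriv (?E c) = fps_deriv c * ?E c" if "c $ 0 = 0" for c :: "'a fps"
    using fps_compose_deriv[OF that, of "fps_exp 1"] by (simp add: mult.commute)
  have "?E (a + b) - ?E a * ?E b = 0"
  proof (rule fps_linear_ode_unique)
    show "fps_deriv (?E (a + b) - ?E a * ?E b) = fps_deriv (a + b) * (?E (a + b) - ?E a * ?E b)"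
      using assms by (simp add: d algebra_simps)
  qed simp
  then show ?thesis by simp
qed

lemma fps_exp_compose_sum:
  fixes a :: "'i \<Rightarrow> 'a :: field_char_0 fps"
  assumes "finite I" "\<And>i. i \<in> I \<Longrightarrow> a i $ 0 = 0"
  shows "fps_exp 1 oo (\<Sum>i\<in>I. a i) = (\<Prod>i\<in>I. fps_exp 1 oo a i)"
  using assms
proof (induction I rule: finite_induct)
  case (insert i I)
  then show ?case by (simp add: fps_exp_compose_add fps_sum_nth)
qed simp

section \<open>Continuity of the coefficients\<close>

lemma continuous_on_fps_power_nth:
  fixes F :: "'b :: topological_space \<Rightarrow> 'a :: {comm_semiring_1, topological_semigroup_mult, topological_comm_monoid_add} fps"
  assumes "\<And>k. continuous_on S (\<lambda>x. F x $ k)"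
  shows "continuous_on S (\<lambda>x. (F x ^ m) $ k)"
proof (induction m arbitrary: k)
  case (Suc m)
  then show ?case by (auto simp: fps_mult_nth intro!: continuous_intros assms)
qed simp

lemma continuous_on_bernoulli_poly:
  "continuous_on S (bernoulli_poly k)"
proof -
  let ?g = "fps_exp (1::real) - 1"
  have "?g $ 1 \<noteq> 0" by simp
  then have "?g \<noteq> 0" by force
  moreover have "subdegree ?g = 1" by (rule subdegreeI) auto
  ultimately have "?g dvd fps_X" by (simp add: fps_dvd_iff)
  \<comment> \<open>Only \<open>fps_exp x\<close> depends on \<open>x\<close>. Since
    \<open>?g\<close> divides \<open>fps_X\<close>, the quotient \<open>fps_X / ?g\<close> is a
    fixed power series, and every coefficient of the product is a polynomial in
    \<open>x\<close>.\<close>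
  then have "fps_X * fps_exp x / ?g = fps_exp x * (fps_X / ?g)" for x
    by (metis div_mult_swap mult.commute)
  then have "bernoulli_poly k =
      (\<lambda>x. fact k * (\<Sum>i=0..k. x ^ i / fact i * (fps_X / ?g) $ (k - i)))"
    by (auto simp: bernoulli_poly_def fps_mult_nth)
  then show ?thesis by (auto intro!: continuous_intros)
qed

text \<open>The contribution of one coordinate, with \<open>q\<close> for \<open>p i\<close> and
  \<open>t\<close> for \<open>\<theta> i\<close>, to the generating series of \<open>Qfun\<close>.
  The minus sign in front of the sum in \<open>cfun\<close> turns \<open>(-1) ^ (k + 1)\<close> into
  \<open>(-1) ^ k\<close>.\<close>

definition Qfactor :: "real \<Rightarrow> real \<Rightarrow> real fps" where
  "Qfactor q t = fps_exp 1 oo Abs_fps (\<lambda>k. if k = 0 then 0 else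
     (-1) ^ k / (real k * (real k + 1)) * (q powi (- int k) * bernoulli_poly (k + 1) (1 - t)))"

lemma Qfactor_nth_0 [simp]: "Qfactor q t $ 0 = 1"
  by (simp add: Qfactor_def)

lemma continuous_on_Qfactor_nth: "continuous_on S (\<lambda>t. Qfactor q t $ k)"
  unfolding Qfactor_def fps_compose_nth
proof (intro continuous_intros continuous_on_fps_power_nth)
  fix k
  have "continuous_on S (\<lambda>t. bernoulli_poly (k + 1) (1 - t))"
    by (rule continuous_on_compose2[OF continuous_on_bernoulli_poly[of UNIV]])
       (auto intro!: continuous_intros)
  then show "continuous_on S (\<lambda>t. Abs_fps (\<lambda>k. if k = 0 then 0 else
     (-1) ^ k / (real k * (real k + 1)) * (q powi (- int k) * bernoulli_poly (k + 1) (1 - t))) $ k)"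
    by (cases "k = 0") (auto intro!: continuous_intros)
qed

section \<open>Monomial expansion of \<open>Qfun\<close>\<close>

text \<open>The exponential turns the sum over coordinates into a product. The numbers
  \<open>e k\<close> are the coefficients of the factor free of \<theta>, and a multiset
  \<open>X\<close> of size \<open>j - k\<close> records which degree \<open>count X i\<close> is
  taken from the factor of coordinate \<open>i\<close>.\<close>

lemma Qfun_expansion:
  obtains e where "\<And>\<theta>. Qfun n p j \<theta> = (\<Sum>k=0..j. \<Sum>X\<in>multisets_of_size {1..n} (j - k).
      e k * (\<Prod>i\<in>{1..n}. Qfactor (p i) (\<theta> i) $ count X i))"
proof -
  define a where "a = Abs_fps (\<lambda>k. if k = 0 then 0 else
    (-1) ^ (k + 1) / (real k * (real k + 1)) * bernoulli_poly (k + 1) 0)"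
  define b where "b q t = Abs_fps (\<lambda>k. if k = 0 then 0 else
     (-1) ^ k / (real k * (real k + 1)) * (q powi (- int k) * bernoulli_poly (k + 1) (1 - t)))"
    for q t :: real
  have "Qfun n p j \<theta> = (\<Sum>k=0..j. \<Sum>X\<in>multisets_of_size {1..n} (j - k).
      (fps_exp 1 oo a) $ k * (\<Prod>i\<in>{1..n}. Qfactor (p i) (\<theta> i) $ count X i))" for \<theta>
  proof -
    have "Abs_fps (\<lambda>k. if k = 0 then 0 else cfun n p k \<theta>) = a + (\<Sum>i=1..n. b (p i) (\<theta> i))"
      by (rule fps_ext)
         (simp add: a_def b_def cfun_def fps_sum_nth right_diff_distrib sum_distrib_left sum_divide_distrib sum_negf)
    moreover have "fps_exp 1 oo (a + (\<Sum>i=1..n. b (p i) (\<theta> i)))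
        = (fps_exp 1 oo a) * (\<Prod>i\<in>{1..n}. Qfactor (p i) (\<theta> i))"
    proof -
      have "a $ 0 = 0" "\<And>q t. b q t $ 0 = 0" by (simp_all add: a_def b_def)
      then show ?thesis
        by (simp add: fps_exp_compose_add fps_exp_compose_sum fps_sum_nth Qfactor_def flip: b_def)
    qed
    ultimately show ?thesis
      by (simp add: Qfun_def fps_mult_nth fps_prod_nth' sum_distrib_left)
  qed
  then show ?thesis by (rule that)
qed

section \<open>Two models of the uniform law\<close>

lemma prob_space_unif: "prob_space (uniform_measure lborel {0..<1::real})"
  by (rule prob_space_uniform_measure) auto

text \<open>\<open>unit_measure\<close> lives on [0,1), as the coordinates of the torus do, while
  \<open>unif_product\<close> is built from a measure on the whole line. The two measures are not
  equal, but they integrate continuous functions alike.\<close>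

lemma integrable_unif:
  fixes f :: "real \<Rightarrow> real"
  assumes "continuous_on UNIV f"
  shows "integrable unit_measure f" "integrable (uniform_measure lborel {0..<1}) f"
    "integral\<^sup>L unit_measure f = integral\<^sup>L (uniform_measure lborel {0..<1}) f"
proof -
  have [measurable]: "f \<in> borel_measurable borel"
    using assms by (rule borel_measurable_continuous_onI)
  \<comment> \<open>A continuous function is bounded on the compact interval, hence integrable there
    and on its half-open part.\<close>
  have "set_integrable lborel {0..1} f"
    by (rule borel_integrable_atLeastAtMost') (use assms continuous_on_subset in blast)
  then have "set_integrable lborel {0..<1} f"
    by (rule set_integrable_subset) auto
  then have i: "integrable lborel (\<lambda>x. indicator {0..<1} x *\<^sub>R f x)"
    by (simp add: set_integrable_def)
  \<comment> \<open>The normalising constant is the length 1 of the interval.\<close>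
  have u: "uniform_measure lborel {0..<1} = density lborel (\<lambda>x. ennreal (indicator {0..<1::real} x))"
    by (auto simp: uniform_measure_def intro!: density_cong split: split_indicator)
  show "integrable unit_measure f"
    unfolding unit_measure_def using i by (subst integrable_restrict_space) auto
  show "integrable (uniform_measure lborel {0..<1}) f"
    unfolding u using i by (subst integrable_density) auto
  show "integral\<^sup>L unit_measure f = integral\<^sup>L (uniform_measure lborel {0..<1}) f"
    unfolding u unit_measure_def
    by (subst integral_restrict_space, simp, subst integral_density) auto
qed

section \<open>Marginals of Haar measure on H\<close>

lemma torus_add_measurable:
  assumes "\<phi> \<in> torus_H n"
  shows "torus_add n \<phi> \<in> measurable (H_borel n) (H_borel n)"
proof -
  have "(\<lambda>x. x i) \<in> borel_measurable (torus_borel n)" if "i \<in> {1..n}" for i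
    unfolding torus_borel_def
    using measurable_component_singleton[OF that] id_unit_borel by (rule measurable_compose)
  then have add1: "torus_add n \<phi> \<in> measurable (torus_borel n) (torus_borel n)"
    unfolding torus_add_def by (subst (2) torus_borel_def)
      (intro measurable_restrict frac_measurable_unit borel_measurable_add borel_measurable_const)
  show ?thesis
    unfolding H_borel_def
  proof (rule measurable_restrict_space2[OF _ measurable_restrict_space1[OF add1]], rule funcsetI)
    fix x assume "x \<in> space (restrict_space (torus_borel n) (torus_H n))"
    then have x: "x \<in> torus_H n" using space_H_borel by (simp add: H_borel_def)
    have "(\<Sum>i=1..n. frac (\<phi> i + x i)) = (\<Sum>i=1..n. \<phi> i) + (\<Sum>i=1..n. x i) - (\<Sum>i=1..n. of_int \<lfloor>\<phi> i + x i\<rfloor>)"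
      by (simp add: frac_def sum.distrib sum_subtractf)
    also have "\<dots> \<in> \<int>"
      using assms x by (intro Ints_diff Ints_add Ints_sum[of _ "\<lambda>i. of_int (f i)" for f])
        (auto simp: torus_H_def)
    finally show "torus_add n \<phi> x \<in> torus_H n"
      by (auto simp: torus_H_def torus_add_def frac_lt_1)
  qed
qed

text \<open>Uniqueness of Haar measure: averaging the invariant law \<open>\<nu>\<close> of the remaining coordinates over
  all translations gives \<open>\<nu> = \<nu> * P = P\<close>, because \<open>P\<close> is translation invariant too.\<close>
lemma haar_prob_H_marginal:
  assumes haar: "haar_prob_H n \<mu>" and m: "m \<in> {1..n}"
  defines "J \<equiv> {1..n} - {m}"
  defines "P \<equiv> PiM J (\<lambda>_. unit_measure)"
  shows "(\<lambda>x. restrict x J) \<in> measurable \<mu> P" "distr \<mu> P (\<lambda>x. restrict x J) = P"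
proof -
  let ?R = "\<lambda>x :: nat \<Rightarrow> real. restrict x J"
  let ?T = "\<lambda>\<phi> x. \<lambda>i\<in>J. frac (\<phi> i + x i :: real)"
  have sets_\<mu>: "sets \<mu> = sets (H_borel n)" and inv: "\<And>\<phi>. \<phi> \<in> torus_H n \<Longrightarrow> distr \<mu> \<mu> (torus_add n \<phi>) = \<mu>"
    using haar by (auto simp: haar_prob_H_def)
  interpret \<mu>: prob_space \<mu> using haar by (simp add: haar_prob_H_def)
  have P: "prob_space P"
    unfolding P_def by (intro prob_space_PiM prob_space_unit_measure)
  have comp: "(\<lambda>x. x i) \<in> borel_measurable P" if "i \<in> J" for i
    using measurable_component_singleton[OF that, of "\<lambda>_. unit_measure"] id_unit_borel
    unfolding P_def measurable_cong_sets[OF refl sets_unit_measure] by (rule measurable_compose)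
  have setsP: "sets P = sets (PiM J (\<lambda>_. restrict_space borel {0..<1}))"
    unfolding P_def by (intro sets_PiM_cong) (auto simp: sets_unit_measure)
  have "?R \<in> measurable (H_borel n) (PiM J (\<lambda>_. restrict_space borel {0..<1}))"
    unfolding H_borel_def torus_borel_def
    by (intro measurable_restrict_space1 measurable_restrict_subset) (auto simp: J_def)
  then show R: "?R \<in> measurable \<mu> P"
    by (simp cong: measurable_cong_sets add: sets_\<mu> setsP)
  let ?\<nu> = "distr \<mu> P ?R"
  interpret \<nu>: prob_space ?\<nu> using R by (rule \<mu>.prob_space_distr)
  interpret P: prob_space P by fact
  interpret pair_sigma_finite P ?\<nu> ..
  have T_pair: "(\<lambda>(\<phi>, x). ?T \<phi> x) \<in> measurable (P \<Otimes>\<^sub>M P) P"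
    unfolding split_beta'
  proof (subst measurable_cong_sets[OF refl setsP], rule measurable_restrict)
    fix i assume i: "i \<in> J"
    show "(\<lambda>z. frac (fst z i + snd z i)) \<in> measurable (P \<Otimes>\<^sub>M P) (restrict_space borel {0..<1})"
      by (intro frac_measurable_unit borel_measurable_add
          measurable_compose[OF measurable_fst comp[OF i]] measurable_compose[OF measurable_snd comp[OF i]])
  qed
  have T: "?T \<phi> \<in> measurable P P" "distr P P (?T \<phi>) = P" for \<phi>
    using PiM_unit_translate[of J \<phi>] by (simp_all add: J_def P_def)
  have \<nu>_inv: "distr ?\<nu> P (?T \<phi>) = ?\<nu>" if \<phi>: "\<phi> \<in> space P" for \<phi>
  proof -
    \<comment> \<open>A shift of the coordinates in \<open>J\<close> is completed to an element of
      H: the coordinate at \<open>m\<close> is the one that makes the sum an integer.\<close>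
    define \<psi> where "\<psi> = (\<lambda>i\<in>{1..n}. if i = m then frac (- (\<Sum>k\<in>J. \<phi> k)) else \<phi> i)"
    have I: "{1..n} = insert m J" using m by (auto simp: J_def)
    have mJ: "m \<notin> J" "finite J" by (auto simp: J_def)
    have "(\<Sum>i=1..n. \<psi> i) = frac (- (\<Sum>k\<in>J. \<phi> k)) + (\<Sum>k\<in>J. \<phi> k)"
    proof -
      have "(\<Sum>k\<in>J. \<psi> k) = (\<Sum>k\<in>J. \<phi> k)"
        by (rule sum.cong) (auto simp: \<psi>_def J_def)
      then show ?thesis unfolding I using m mJ by (simp add: \<psi>_def)
    qed
    also have "\<dots> \<in> \<int>" by (simp add: frac_def)
    finally have \<psi>: "\<psi> \<in> torus_H n"
      using \<phi> by (auto simp: torus_H_def \<psi>_def P_def space_PiM J_def PiE_iff frac_lt_1)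
    have t: "torus_add n \<psi> \<in> measurable \<mu> \<mu>"
      using torus_add_measurable[OF \<psi>] by (simp cong: measurable_cong_sets add: sets_\<mu>)
    \<comment> \<open>Dropping coordinate \<open>m\<close> intertwines the translations by \<psi>
      and by \<phi>, so invariance descends from \<open>\<mu>\<close> to its image
      \<open>?\<nu>\<close>.\<close>
    have eq: "?T \<phi> \<circ> ?R = ?R \<circ> torus_add n \<psi>"
      by (auto simp: fun_eq_iff torus_add_def \<psi>_def J_def restrict_def)
    have "distr ?\<nu> P (?T \<phi>) = distr \<mu> P (?R \<circ> torus_add n \<psi>)"
      unfolding distr_distr[OF T(1) R] eq ..
    also have "\<dots> = distr (distr \<mu> \<mu> (torus_add n \<psi>)) P ?R"
      by (rule distr_distr[OF R t, symmetric])
    finally show ?thesis unfolding inv[OF \<psi>] .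
  qed
  show "?\<nu> = P"
  proof (rule measure_eqI)
    fix A assume "A \<in> sets ?\<nu>"
    then have A[measurable]: "A \<in> sets P" by simp
    have ind: "(\<lambda>(\<phi>, x). indicator A (?T \<phi> x) :: ennreal) \<in> borel_measurable (P \<Otimes>\<^sub>M ?\<nu>)"
      using measurable_compose[OF T_pair borel_measurable_indicator[OF A]]
      by (simp add: split_beta' cong: measurable_cong_sets)
    \<comment> \<open>Stated for a general \<open>M\<close> because it serves twice: for
      \<open>?\<nu>\<close> before the integrals are exchanged and for \<open>P\<close>
      afterwards.\<close>
    have shift: "(\<integral>\<^sup>+x. indicator A (?T \<phi> x) \<partial>M) = emeasure M A"
      if "distr M P (?T \<phi>) = M" "sets M = sets P" for M \<phi>
    proof -
      have "?T \<phi> \<in> measurable M P"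
        using T(1)[of \<phi>] that(2) by (simp cong: measurable_cong_sets)
      then have "(\<integral>\<^sup>+x. indicator A (?T \<phi> x) \<partial>M) = (\<integral>\<^sup>+x. indicator A x \<partial>distr M P (?T \<phi>))"
        by (subst nn_integral_distr) auto
      then show ?thesis using that A by simp
    qed
    have "emeasure ?\<nu> A = (\<integral>\<^sup>+\<phi>. emeasure ?\<nu> A \<partial>P)"
      by (simp add: P.emeasure_space_1)
    also have "\<dots> = (\<integral>\<^sup>+\<phi>. \<integral>\<^sup>+x. indicator A (?T \<phi> x) \<partial>?\<nu> \<partial>P)"
      by (intro nn_integral_cong shift[symmetric] \<nu>_inv) auto
    also have "\<dots> = (\<integral>\<^sup>+x. \<integral>\<^sup>+\<phi>. indicator A (?T \<phi> x) \<partial>P \<partial>?\<nu>)"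
      using Fubini'[OF ind] by simp
    also have "\<dots> = (\<integral>\<^sup>+x. emeasure P A \<partial>?\<nu>)"
    proof (rule nn_integral_cong)
      fix x
      \<comment> \<open>Commutativity exchanges the roles of shift and point: with \<open>x\<close>
        fixed, \<phi> is now the point being translated, and its law \<open>P\<close> is
        invariant.\<close>
      have "?T \<phi> x = ?T x \<phi>" for \<phi> by (simp add: add.commute)
      then show "(\<integral>\<^sup>+\<phi>. indicator A (?T \<phi> x) \<partial>P) = emeasure P A"
        using shift[OF T(2)[of x]] by simp
    qed
    also have "\<dots> = emeasure P A"
      by (simp only: nn_integral_const \<nu>.emeasure_space_1 mult_1_right)
    finally show "emeasure ?\<nu> A = emeasure P A" .
  qed simp
qed

section \<open>Expectations of monomials omitting a coordinate\<close>

text \<open>Since \<open>f m\<close> is constantly 1, the product depends only on the coordinates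
  other than \<open>m\<close>. Under \<open>\<mu>\<close> these are independent and uniform, so both
  integrals factor into the same one-dimensional ones.\<close>

lemma integral_prod_haar:
  fixes f :: "nat \<Rightarrow> real \<Rightarrow> real"
  assumes haar: "haar_prob_H n \<mu>" and m: "m \<in> {1..n}" and fm: "\<And>t. f m t = 1"
    and cont: "\<And>i. continuous_on UNIV (f i)"
  shows "integrable \<mu> (\<lambda>\<theta>. \<Prod>i=1..n. f i (\<theta> i))"
    and "integrable (unif_product n) (\<lambda>\<theta>. \<Prod>i=1..n. f i (\<theta> i))"
    and "(\<integral>\<theta>. (\<Prod>i=1..n. f i (\<theta> i)) \<partial>\<mu>) = (\<integral>\<theta>. (\<Prod>i=1..n. f i (\<theta> i)) \<partial>unif_product n)"
proof -
  define J where "J = {1..n} - {m}"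
  let ?P = "PiM J (\<lambda>_. unit_measure)"
  let ?U = "uniform_measure lborel {0..<1::real}"
  interpret V: product_sigma_finite "\<lambda>_ :: nat. unit_measure"
    using prob_space_unit_measure by (simp add: product_sigma_finite_def prob_space_imp_sigma_finite)
  interpret U: product_sigma_finite "\<lambda>_ :: nat. ?U"
    using prob_space_unif by (simp add: product_sigma_finite_def prob_space_imp_sigma_finite)
  interpret U1: prob_space ?U by (rule prob_space_unif)
  have R: "(\<lambda>x. restrict x J) \<in> measurable \<mu> ?P" "distr \<mu> ?P (\<lambda>x. restrict x J) = ?P"
    using haar_prob_H_marginal[OF haar m] by (simp_all add: J_def)
  have fin: "finite J" by (simp add: J_def)
  have prod_J: "(\<Prod>i=1..n. g i) = (\<Prod>i\<in>J. g i)" if "g m = (1::real)" for g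
    using prod.remove[OF _ m, of g] that by (simp add: J_def)
  have eq: "(\<Prod>i=1..n. f i (\<theta> i)) = (\<Prod>i\<in>J. f i (restrict \<theta> J i))" for \<theta>
    using prod_J[of "\<lambda>i. f i (\<theta> i)"] fm by simp
  have int_P: "integrable ?P (\<lambda>x. \<Prod>i\<in>J. f i (x i))"
    by (intro V.product_integrable_prod fin integrable_unif cont)
  then have meas: "(\<lambda>x. \<Prod>i\<in>J. f i (x i)) \<in> borel_measurable ?P" by auto
  show "integrable \<mu> (\<lambda>\<theta>. \<Prod>i=1..n. f i (\<theta> i))"
    unfolding eq using integrable_distr_eq[OF R(1) meas] int_P unfolding R(2) by simp
  show "integrable (unif_product n) (\<lambda>\<theta>. \<Prod>i=1..n. f i (\<theta> i))"
    unfolding unif_product_def by (intro U.product_integrable_prod integrable_unif cont) simp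
  have "(\<integral>\<theta>. (\<Prod>i=1..n. f i (\<theta> i)) \<partial>\<mu>) = (\<integral>x. (\<Prod>i\<in>J. f i (x i)) \<partial>?P)"
    unfolding eq using integral_distr[OF R(1) meas] unfolding R(2) by simp
  also have "\<dots> = (\<Prod>i\<in>J. integral\<^sup>L ?U (f i))"
    by (subst V.product_integral_prod) (simp_all add: fin integrable_unif cont)
  \<comment> \<open>The missing factor can be put back: it is the total mass 1 of the uniform
    law.\<close>
  also have "\<dots> = (\<Prod>i=1..n. integral\<^sup>L ?U (f i))"
    by (rule prod_J[symmetric]) (simp add: fm[abs_def] U1.prob_space[simplified])
  also have "\<dots> = (\<integral>\<theta>. (\<Prod>i=1..n. f i (\<theta> i)) \<partial>unif_product n)"
    unfolding unif_product_def
    by (rule U.product_integral_prod[symmetric]) (simp_all add: integrable_unif cont)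
  finally show "(\<integral>\<theta>. (\<Prod>i=1..n. f i (\<theta> i)) \<partial>\<mu>) = (\<integral>\<theta>. (\<Prod>i=1..n. f i (\<theta> i)) \<partial>unif_product n)" .
qed

theorem proposition6p1:
  fixes n j :: nat and p :: "nat \<Rightarrow> real" and \<mu>\<^sub>H :: "(nat \<Rightarrow> real) measure"
  assumes "n \<ge> 2"
    and "\<And>i. i \<in> {1..n} \<Longrightarrow> p i > 0"
    and "(\<Sum>i=1..n. p i) = 1"
    and "generic n p"
    and "haar_prob_H n \<mu>\<^sub>H"
    and "j \<le> n - 1"
  shows "(\<integral>\<theta>. Qfun n p j \<theta> \<partial>\<mu>\<^sub>H) = (\<integral>\<theta>. Qfun n p j \<theta> \<partial>unif_product n)"
proof -
  obtain e where e: "\<And>\<theta>. Qfun n p j \<theta> = (\<Sum>k=0..j. \<Sum>X\<in>multisets_of_size {1..n} (j - k).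
      e k * (\<Prod>i\<in>{1..n}. Qfactor (p i) (\<theta> i) $ count X i))"
    using Qfun_expansion[of n p j] by blast
  have monomials: "integrable \<mu>\<^sub>H (\<lambda>\<theta>. \<Prod>i=1..n. Qfactor (p i) (\<theta> i) $ count X i)"
    "integrable (unif_product n) (\<lambda>\<theta>. \<Prod>i=1..n. Qfactor (p i) (\<theta> i) $ count X i)"
    "(\<integral>\<theta>. (\<Prod>i=1..n. Qfactor (p i) (\<theta> i) $ count X i) \<partial>\<mu>\<^sub>H)
      = (\<integral>\<theta>. (\<Prod>i=1..n. Qfactor (p i) (\<theta> i) $ count X i) \<partial>unif_product n)"
    if X: "X \<in> multisets_of_size {1..n} (j - k)" for X k
  proof -
    \<comment> \<open>Each element of the support is counted at least once, so at most
      \<open>j - k\<close> coordinates occur. This is less than \<open>n\<close> because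
      \<open>j \<le> n - 1\<close>.\<close>
    have "card (set_mset X) \<le> size X"
      using sum_mono[of "set_mset X" "\<lambda>_. 1" "count X"]
      by (simp add: size_multiset_overloaded_eq Suc_le_eq)
    also have "\<dots> < card {1..n}"
      using X \<open>j \<le> n - 1\<close> \<open>n \<ge> 2\<close> by (auto simp: multisets_of_size_def)
    finally have "\<not> {1..n} \<subseteq> set_mset X"
      using card_mono[of "set_mset X" "{1..n}"] by auto
    \<comment> \<open>The factor of the omitted coordinate is a constant term
      \<open>Qfactor (p m) t $ 0\<close>, which is 1, as \<open>integral_prod_haar\<close>
      requires.\<close>
    then obtain m where m: "m \<in> {1..n}" "count X m = 0"
      by (metis subsetI not_in_iff)
    show "integrable \<mu>\<^sub>H (\<lambda>\<theta>. \<Prod>i=1..n. Qfactor (p i) (\<theta> i) $ count X i)"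
      "integrable (unif_product n) (\<lambda>\<theta>. \<Prod>i=1..n. Qfactor (p i) (\<theta> i) $ count X i)"
      "(\<integral>\<theta>. (\<Prod>i=1..n. Qfactor (p i) (\<theta> i) $ count X i) \<partial>\<mu>\<^sub>H)
        = (\<integral>\<theta>. (\<Prod>i=1..n. Qfactor (p i) (\<theta> i) $ count X i) \<partial>unif_product n)"
      using m by (intro integral_prod_haar[OF \<open>haar_prob_H n \<mu>\<^sub>H\<close> m(1)] continuous_on_Qfactor_nth; simp)+
  qed
  \<comment> \<open>Linearity is stated for any measure under which the monomials are integrable, so
    that it applies on both sides.\<close>
  have integral_Qfun: "(\<integral>\<theta>. Qfun n p j \<theta> \<partial>M) = (\<Sum>k=0..j. \<Sum>X\<in>multisets_of_size {1..n} (j - k).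
      e k * (\<integral>\<theta>. (\<Prod>i=1..n. Qfactor (p i) (\<theta> i) $ count X i) \<partial>M))"
    if int: "\<And>k X. X \<in> multisets_of_size {1..n} (j - k) \<Longrightarrow>
      integrable M (\<lambda>\<theta>. \<Prod>i=1..n. Qfactor (p i) (\<theta> i) $ count X i)" for M
    unfolding e
    by (subst Bochner_Integration.integral_sum
        | intro Bochner_Integration.integrable_sum integrable_mult_right int sum.cong refl
            integral_mult_right_zero
        | assumption)+
  have "(\<integral>\<theta>. Qfun n p j \<theta> \<partial>\<mu>\<^sub>H) = (\<Sum>k=0..j. \<Sum>X\<in>multisets_of_size {1..n} (j - k).
      e k * (\<integral>\<theta>. (\<Prod>i=1..n. Qfactor (p i) (\<theta> i) $ count X i) \<partial>\<mu>\<^sub>H))"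
    by (rule integral_Qfun) (erule monomials(1))
  also have "\<dots> = (\<Sum>k=0..j. \<Sum>X\<in>multisets_of_size {1..n} (j - k).
      e k * (\<integral>\<theta>. (\<Prod>i=1..n. Qfactor (p i) (\<theta> i) $ count X i) \<partial>unif_product n))"
    by (intro sum.cong refl arg_cong2[where f="(*)"]) (erule monomials(3))
  also have "\<dots> = (\<integral>\<theta>. Qfun n p j \<theta> \<partial>unif_product n)"
    by (rule integral_Qfun[symmetric]) (erule monomials(2))
  finally show ?thesis .
qed

end
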